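(* If $n$ is an integer such that $n\ge 3$, then $$\mathcal{P}(P_n) = \frac{1}{2}+\frac{1}{6n},$$ where $P_n$ is the path graph on $n$ vertices and $\mathcal{P}(T)$ is the probability that the first player wins the tree search game on $T$ when both players play uniformly at random.
   Context: A tree is a connected acyclic undirected graph with a finite, positive number of vertices; $|T|$ is the number of vertices of $T$; $T\smallsetminus v$ is the forest obtained by deleting $v$ and its incident edges. Tree search game on $T$: one vertex of $T$ is selected uniformly at random as the target, unknown to both players. The players alternately guess vertices. If the guess $v$ is the target, the player who made it wins. Otherwise both players are informed which component of $T\smallsetminus v$ contains the target, and the game continues on that component with the other player to move. $\mathcal{P}(T)$ is the probability that the first player wins on $T$ when both players always choose a vertex uniformly at random from among the vertices that could still be the target. Equivalently, with $n=|T|$, it is determined recursively by $$\mathcal{P}(T)=1-\frac1{n^2}\sum_{v\in V(T)}\sum_{T'}|T'|\,\mathcal{P}(T'),$$ where $T'$ ranges over the components of $T\smallsetminus v$ (empty sums are $0$). *)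

theory Defs
  imports "HOL-Probability.Probability" "Graph_Theory.Graph_Theory"
begin

text \<open>
  Undirected graphs are the symmetric digraphs of \<^theory>\<open>Graph_Theory.Digraph\<close> (locale
  \<^locale>\<open>graph\<close>), whose connected components are their strongly connected components. The
  predicate \<^const>\<open>tree\<close> of that library excludes directed cycles, so it does not describe trees
  in this representation, where every edge is a directed cycle of length two. The definitions
  below make sense for every finite graph, so no tree predicate is needed.
\<close>

text \<open>The component of \<open>T - v\<close> that contains \<open>t\<close>, for \<open>t \<noteq> v\<close>.\<close>

definition component_after ::
    "('a, 'b) pre_digraph \<Rightarrow> 'a \<Rightarrow> 'a \<Rightarrow> ('a, 'b) pre_digraph" where
  "component_after T v t = T \<restriction> pre_digraph.scc_of (pre_digraph.del_vert T v) t"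

lemma verts_component_after_subset: "verts (component_after T v t) \<subseteq> verts T - {v}"
proof
  fix w assume "w \<in> verts (component_after T v t)"
  then have "w \<in> pre_digraph.scc_of (pre_digraph.del_vert T v) t"
    by (simp add: component_after_def)
  then have "w \<in> verts (pre_digraph.del_vert T v)"
    by (auto simp: pre_digraph.scc_of_def elim: reachable_in_vertsE)
  then show "w \<in> verts T - {v}"
    by (simp add: pre_digraph.verts_del_vert)
qed

text \<open>
  The play of the tree search game on \<open>T\<close> with target \<open>t\<close>, both players guessing uniformly at
  random among the vertices that could still be the target. The outcome is \<open>True\<close> iff the
  player about to move wins; the negation accounts for the change of the player to move.
  The test only serves to make the function total.
\<close>

function play :: "('a, 'b) pre_digraph \<Rightarrow> 'a \<Rightarrow> bool pmf" where
  "play T t =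
    (if finite (verts T) \<and> t \<in> verts T then
       do {
         v \<leftarrow> pmf_of_set (verts T);
         if v = t then return_pmf True
         else map_pmf Not (play (component_after T v t) t)
       }
     else return_pmf False)"
  by pat_completeness auto
termination
proof (relation "Wellfounded.measure (\<lambda>(T, t). card (verts T))")
  fix T :: "('a, 'b) pre_digraph" and t v :: 'a
  assume fin: "finite (verts T) \<and> t \<in> verts T" and v: "v \<in> set_pmf (pmf_of_set (verts T))"
  have "v \<in> verts T"
    using fin v by (metis empty_iff set_pmf_of_set)
  then have "verts (component_after T v t) \<subset> verts T"
    using verts_component_after_subset[of T v t] by blast
  then show "((component_after T v t, t), T, t) \<in> Wellfounded.measure (\<lambda>(T, t). card (verts T))"
    using fin by (simp add: psubset_card_mono)
qed simp

declare play.simps [simp del]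

definition first_player_wins :: "('a, 'b) pre_digraph \<Rightarrow> bool pmf" where
  "first_player_wins T = do { t \<leftarrow> pmf_of_set (verts T); play T t }"

definition win_prob :: "('a, 'b) pre_digraph \<Rightarrow> real" where
  "win_prob T = measure_pmf.prob (first_player_wins T) {True}"

definition path_graph :: "nat \<Rightarrow> nat pair_pre_digraph" where
  "path_graph n =
    \<lparr> pverts = {1..n},
      parcs = {(i, j). i \<in> {1..n} \<and> j \<in> {1..n} \<and> (j = i + 1 \<or> i = j + 1)} \<rparr>"

lemma pair_graph_path_graph: "pair_graph (path_graph n)"
proof
  have "parcs (path_graph n) \<subseteq> {1..n} \<times> {1..n}"
    by (auto simp: path_graph_def)
  then show "finite (parcs (path_graph n))"
    by (rule finite_subset) simp
qed (auto simp: path_graph_def symmetric_def sym_def)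

end

theory Submission
  imports Defs
begin

text \<open>
  Write \<open>S(T)\<close> for the sum, over all targets \<open>t\<close> in \<open>T\<close>, of the probability that the first player
  wins against target \<open>t\<close> (\<open>win_weight\<close>); thus \<open>S(T) = |T| \<cdot> P(T)\<close> (\<open>win_prob_eq_win_weight\<close>).
  Fixing the target and conditioning on the first guess gives
  \<open>|T| \<cdot> S(T) = |T|\<^sup>2 - (\<Sum>v. \<Sum>T'. S(T'))\<close>,
  where the components \<open>T'\<close> of \<open>T - v\<close> appear because every \<open>t \<noteq> v\<close> lies in exactly one of them
  (\<open>win_weight_rec\<close> still has one summand per target).

  On a path, a guess leaves the segment before it and the segment after it
  (\<open>component_after_path_segment\<close>), so \<open>S\<close> depends on the length alone, and its values \<open>s m\<close> satisfy
  \<open>m \<cdot> s m = m\<^sup>2 - 2 \<cdot> (s 0 + \<dots> + s (m - 1))\<close>. The first values are \<open>0, 1, 1\<close>. From \<open>m = 3\<close> on, the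
  partial sums \<open>s 0 + \<dots> + s (m - 1)\<close> are \<open>m (m - 1) / 4 + m / 6\<close>, and hence
  \<open>s m = m / 2 + 1 / 6\<close>. Division by \<open>m\<close> gives the claim.
\<close>

section \<open>The recursion for an arbitrary finite graph\<close>

definition win_weight :: "('a, 'b) pre_digraph \<Rightarrow> real" where
  "win_weight T = (\<Sum>t\<in>verts T. pmf (play T t) True)"

lemma pmf_map_Not: "pmf (map_pmf Not p) True = 1 - pmf p True"
proof -
  have "pmf (map_pmf Not p) True = pmf p False"
    using pmf_map_inj'[of Not p False] by (simp add: inj_def)
  then show ?thesis
    by (simp add: pmf_False_conv_True)
qed

lemma pmf_play_True:
  assumes "finite (verts T)" "t \<in> verts T"
  shows "real (card (verts T)) * pmf (play T t) True
    = real (card (verts T)) - (\<Sum>v\<in>verts T - {t}. pmf (play (component_after T v t) t) True)"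
proof -
  have ne: "verts T \<noteq> {}" and pos: "card (verts T) > 0"
    using assms by (auto simp: card_gt_0_iff)
  have "pmf (play T t) True
      = (\<Sum>v\<in>verts T. pmf (if v = t then return_pmf True
            else map_pmf Not (play (component_after T v t) t)) True) / card (verts T)"
    using assms ne by (subst play.simps) (simp add: pmf_bind integral_pmf_of_set)
  \<comment> \<open>Guessing the target wins; any other guess passes the move to the opponent.\<close>
  also have "(\<Sum>v\<in>verts T. pmf (if v = t then return_pmf True
            else map_pmf Not (play (component_after T v t) t)) True)
      = 1 + (\<Sum>v\<in>verts T - {t}. 1 - pmf (play (component_after T v t) t) True)"
    using assms by (subst sum.remove[of _ t]) (auto simp: pmf_map_Not intro!: sum.cong)
  also have "\<dots> = real (card (verts T))
      - (\<Sum>v\<in>verts T - {t}. pmf (play (component_after T v t) t) True)"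
    using assms pos by (simp add: sum_subtractf of_nat_diff)
  finally show ?thesis
    using pos by simp
qed

text \<open>
  The double sum ranges over ordered pairs of a guess and a different target, so it may be
  arranged by guesses, which is the order in which the components of \<open>T - v\<close> can be collected.
\<close>

lemma win_weight_rec:
  assumes "finite (verts T)"
  shows "real (card (verts T)) * win_weight T = (real (card (verts T)))\<^sup>2
    - (\<Sum>v\<in>verts T. \<Sum>t\<in>verts T - {v}. pmf (play (component_after T v t) t) True)"
proof -
  let ?f = "\<lambda>v t. pmf (play (component_after T v t) t) True"
  have "real (card (verts T)) * win_weight T
      = (\<Sum>t\<in>verts T. real (card (verts T)) - (\<Sum>v\<in>verts T - {t}. ?f v t))"
    unfolding win_weight_def sum_distrib_left
    using assms by (intro sum.cong) (auto simp: pmf_play_True)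
  also have "\<dots> = (real (card (verts T)))\<^sup>2 - (\<Sum>t\<in>verts T. \<Sum>v\<in>verts T - {t}. ?f v t)"
    by (simp add: sum_subtractf power2_eq_square)
  also have "(\<Sum>t\<in>verts T. \<Sum>v\<in>verts T - {t}. ?f v t)
      = (\<Sum>t\<in>verts T. \<Sum>v | v \<in> verts T \<and> t \<noteq> v. ?f v t)"
    by (intro sum.cong) auto
  also have "\<dots> = (\<Sum>v\<in>verts T. \<Sum>t | t \<in> verts T \<and> t \<noteq> v. ?f v t)"
    using assms by (intro sum.swap_restrict) auto
  also have "\<dots> = (\<Sum>v\<in>verts T. \<Sum>t\<in>verts T - {v}. ?f v t)"
    by (intro sum.cong) auto
  finally show ?thesis .
qed

lemma win_prob_eq_win_weight:
  assumes "finite (verts T)" "verts T \<noteq> {}"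
  shows "win_prob T = win_weight T / card (verts T)"
  using assms
  by (simp add: win_prob_def first_player_wins_def measure_pmf_single pmf_bind
      integral_pmf_of_set win_weight_def)

section \<open>Deleting a vertex from a path\<close>

text \<open>
  A segment is given by its first vertex and its length rather than by its two ends, so that the
  empty segments left by guessing an end of the path need no separate treatment.
\<close>

definition path_segment :: "nat \<Rightarrow> nat \<Rightarrow> (nat, nat \<times> nat) pre_digraph" where
  "path_segment a m = with_proj
    \<lparr> pverts = {a..<a + m},
      parcs = {(i, j). i \<in> {a..<a + m} \<and> j \<in> {a..<a + m} \<and> (j = i + 1 \<or> i = j + 1)} \<rparr>"

lemma verts_path_segment [simp]: "verts (path_segment a m) = {a..<a + m}"
  by (simp add: path_segment_def)

lemma with_proj_path_graph: "with_proj (path_graph n) = path_segment 1 n"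
  by (simp add: path_segment_def path_graph_def atLeastLessThanSuc_atLeastAtMost)

lemma (in wf_digraph) reachable_ascending:
  fixes f :: "nat \<Rightarrow> 'a"
  assumes "i \<le> j" "f i \<in> verts G" "\<And>k. i \<le> k \<Longrightarrow> k < j \<Longrightarrow> f k \<rightarrow> f (Suc k)"
  shows "f i \<rightarrow>\<^sup>* f j"
  using assms
proof (induction j rule: dec_induct)
  case base
  then show ?case by simp
next
  case (step k)
  then have "f i \<rightarrow>\<^sup>* f k" "f k \<rightarrow> f (Suc k)" by auto
  then show ?case by (rule reachable_adj_trans)
qed

text \<open>
  An arc joins consecutive numbers, so without \<open>v\<close> no walk passes from below \<open>v\<close> to above it;
  conversely the numbers between two vertices on the same side of \<open>v\<close> form a walk.
\<close>

lemma scc_of_del_vert_path_segment: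
  assumes "t \<in> {a..<a + m}" "t \<noteq> v"
  shows "pre_digraph.scc_of (pre_digraph.del_vert (path_segment a m) v) t
    = {w \<in> {a..<a + m}. w \<noteq> v \<and> (w < v \<longleftrightarrow> t < v)}"
proof -
  define D where "D = pre_digraph.del_vert (path_segment a m) v"
  have verts: "verts D = {a..<a + m} - {v}"
    by (simp add: D_def pre_digraph.verts_del_vert)
  have arc: "i \<rightarrow>\<^bsub>D\<^esub> j \<longleftrightarrow> i \<in> {a..<a + m} - {v} \<and> j \<in> {a..<a + m} - {v} \<and> (j = i + 1 \<or> i = j + 1)"
    for i j
    by (auto simp: D_def pre_digraph.del_vert_def path_segment_def arcs_ends_conv image_iff)
  interpret wf_digraph D
    by unfold_locales (auto simp: D_def pre_digraph.del_vert_def path_segment_def)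
  have sym: "symmetric D"
    unfolding symmetric_def sym_def by (auto simp: arc)
  have side: "w \<in> verts D \<and> (w < v \<longleftrightarrow> t < v)" if "t \<rightarrow>\<^sup>*\<^bsub>D\<^esub> w" for w
    using that
  proof (induction rule: reachable_induct)
    case base
    then show ?case using assms by (simp add: verts)
  next
    case (step x y)
    then show ?case by (auto simp: arc verts)
  qed
  have upward: "i \<rightarrow>\<^sup>*\<^bsub>D\<^esub> j"
    if "i \<le> j" "i \<in> verts D" "j \<in> verts D" "i < v \<longleftrightarrow> j < v" for i j
    using that reachable_ascending[of i j "\<lambda>k. k"] by (auto simp: arc verts)
  have "t \<rightarrow>\<^sup>*\<^bsub>D\<^esub> w \<and> w \<rightarrow>\<^sup>*\<^bsub>D\<^esub> t" if "w \<in> verts D" "w < v \<longleftrightarrow> t < v" for w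
  proof -
    have t: "t \<in> verts D" using assms by (simp add: verts)
    have "t \<rightarrow>\<^sup>*\<^bsub>D\<^esub> w \<or> w \<rightarrow>\<^sup>*\<^bsub>D\<^esub> t"
      using upward[of t w] upward[of w t] t that by (cases "t \<le> w") auto
    then show ?thesis
      using symmetric_reachable[OF sym] by blast
  qed
  then have "scc_of t = {w \<in> verts D. w < v \<longleftrightarrow> t < v}"
    unfolding scc_of_def using side by blast
  then show ?thesis
    unfolding D_def[symmetric] by (auto simp: verts)
qed

lemma induce_subgraph_path_segment:
  assumes "{b..<b + l} \<subseteq> {a..<a + m}"
  shows "path_segment a m \<restriction> {b..<b + l} = path_segment b l"
  using assms unfolding induce_subgraph_def path_segment_def with_proj_def by auto

lemma component_after_path_segment:
  assumes "k < m" "t \<in> {a..<a + m}" "t \<noteq> a + k"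
  shows "component_after (path_segment a m) (a + k) t
    = (if t < a + k then path_segment a k else path_segment (a + k + 1) (m - k - 1))"
proof (cases "t < a + k")
  case True
  have "pre_digraph.scc_of (pre_digraph.del_vert (path_segment a m) (a + k)) t = {a..<a + k}"
    unfolding scc_of_del_vert_path_segment[OF assms(2,3)] using True assms by auto
  then show ?thesis
    using True assms by (simp add: component_after_def induce_subgraph_path_segment)
next
  case False
  have "pre_digraph.scc_of (pre_digraph.del_vert (path_segment a m) (a + k)) t
      = {a + k + 1..<a + k + 1 + (m - k - 1)}"
    unfolding scc_of_del_vert_path_segment[OF assms(2,3)] using False assms by auto
  moreover have "{a + k + 1..<a + k + 1 + (m - k - 1)} \<subseteq> {a..<a + m}"
    using assms by auto
  ultimately show ?thesis
    using False by (simp only: component_after_def induce_subgraph_path_segment if_False)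
qed

section \<open>Solving the recursion on paths\<close>

lemma win_weight_path_segment_rec:
  "real m * win_weight (path_segment a m) = (real m)\<^sup>2
    - (\<Sum>k<m. win_weight (path_segment a k) + win_weight (path_segment (a + k + 1) (m - k - 1)))"
proof -
  let ?f = "\<lambda>v t. pmf (play (component_after (path_segment a m) v t) t) True"
  have split: "(\<Sum>t\<in>{a..<a + m} - {a + k}. ?f (a + k) t)
      = win_weight (path_segment a k) + win_weight (path_segment (a + k + 1) (m - k - 1))"
    if "k < m" for k
  proof -
    have "{a..<a + m} - {a + k} = {a..<a + k} \<union> {a + k + 1..<a + k + 1 + (m - k - 1)}"
      using that by auto
    then have "(\<Sum>t\<in>{a..<a + m} - {a + k}. ?f (a + k) t)
        = (\<Sum>t\<in>{a..<a + k}. ?f (a + k) t)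
          + (\<Sum>t\<in>{a + k + 1..<a + k + 1 + (m - k - 1)}. ?f (a + k) t)"
      by (simp only:) (rule sum.union_disjoint, auto)
    also have "\<dots> = win_weight (path_segment a k) + win_weight (path_segment (a + k + 1) (m - k - 1))"
      unfolding win_weight_def verts_path_segment
      using that by (intro arg_cong2[where f = "(+)"] sum.cong) (auto simp: component_after_path_segment)
    finally show ?thesis .
  qed
  have "(\<Sum>v\<in>{a..<a + m}. \<Sum>t\<in>{a..<a + m} - {v}. ?f v t)
      = (\<Sum>k<m. \<Sum>t\<in>{a..<a + m} - {a + k}. ?f (a + k) t)"
    by (rule sum.reindex_bij_witness[of _ "\<lambda>k. a + k" "\<lambda>v. v - a"]) auto
  also have "\<dots> = (\<Sum>k<m. win_weight (path_segment a k) + win_weight (path_segment (a + k + 1) (m - k - 1)))"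
    by (intro sum.cong) (auto simp: split)
  finally show ?thesis
    using win_weight_rec[of "path_segment a m"] by simp
qed

text \<open>
  This is the sequence \<open>s\<close> determined by \<open>m \<cdot> s m = m\<^sup>2 - 2 \<cdot> (s 0 + \<dots> + s (m - 1))\<close> and
  \<open>s 0 = 0\<close>. Its first three values break the linear pattern.
\<close>

definition path_weight :: "nat \<Rightarrow> real" where
  "path_weight m = (if m = 0 then 0 else if m \<le> 2 then 1 else real m / 2 + 1 / 6)"

text \<open>
  The deviations of \<open>s 0\<close>, \<open>s 1\<close>, \<open>s 2\<close> from \<open>m / 2 + 1 / 6\<close> are \<open>- 1 / 6\<close>, \<open>1 / 3\<close> and \<open>- 1 / 6\<close>. They
  cancel, so from \<open>m = 3\<close> on the partial sums are those of the linear sequence.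
\<close>

lemma sum_path_weight:
  assumes "m \<ge> 3"
  shows "(\<Sum>k<m. path_weight k) = real m * (real m - 1) / 4 + real m / 6"
  using assms
proof (induction m rule: nat_induct_at_least)
  case base
  show ?case by (simp add: path_weight_def eval_nat_numeral)
next
  case (Suc m)
  then show ?case by (simp add: path_weight_def field_simps)
qed

lemma path_weight_rec:
  "real m * path_weight m = (real m)\<^sup>2 - 2 * (\<Sum>k<m. path_weight k)"
proof (cases "m \<ge> 3")
  case True
  then show ?thesis
    by (simp add: sum_path_weight) (simp add: path_weight_def power2_eq_square field_simps)
next
  case False
  then have "m = 0 \<or> m = 1 \<or> m = 2" by auto
  then show ?thesis by (auto simp: path_weight_def eval_nat_numeral)
qed

lemma win_weight_path_segment: "win_weight (path_segment a m) = path_weight m"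
proof (induction m arbitrary: a rule: less_induct)
  case (less m)
  show ?case
  proof (cases "m = 0")
    case True
    then show ?thesis by (simp add: win_weight_def path_weight_def)
  next
    case False
    have "(\<Sum>k<m. win_weight (path_segment a k) + win_weight (path_segment (a + k + 1) (m - k - 1)))
        = (\<Sum>k<m. path_weight k + path_weight (m - Suc k))"
      by (intro sum.cong) (auto simp: less.IH)
    \<comment> \<open>The lengths after the guess are the lengths before it in reverse order.\<close>
    also have "\<dots> = 2 * (\<Sum>k<m. path_weight k)"
      by (simp add: sum.distrib sum.nat_diff_reindex)
    finally have "real m * win_weight (path_segment a m) = real m * path_weight m"
      by (simp only: win_weight_path_segment_rec path_weight_rec)
    then show ?thesis using False by simp
  qed
qed

theorem theorem5p2:
  fixes n :: nat
  assumes "n \<ge> 3"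
  shows "win_prob (with_proj (path_graph n)) = 1 / 2 + 1 / (6 * real n)"
proof -
  have "win_prob (with_proj (path_graph n)) = path_weight n / real n"
    using assms by (simp add: with_proj_path_graph win_prob_eq_win_weight win_weight_path_segment)
  then show ?thesis
    using assms by (simp add: path_weight_def field_simps)
qed

end
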